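(* Let $X$ be a linearly ordered set with $|X|\geq 4$. Then there exists no transitive binary relation $\succeq$ on $\mathcal{X}=2^X\setminus\{\emptyset\}$ satisfying the Gärdenfors principle (GF), bottom independence (botIND) as well as top independence (topIND), and simple uncertainty aversion (SUAv).
   Context: $X$ is linearly ordered by $\dot{\geq}$ (reflexive, complete, transitive, antisymmetric), with strict part $x\mathrel{\dot{>}}y$ iff $x\mathrel{\dot{\geq}}y$ and not $y\mathrel{\dot{\geq}}x$; $x\mathrel{\dot{<}}y$ means $y\mathrel{\dot{>}}x$. $\mathcal{X}=2^X\setminus\{\emptyset\}$ is the set of nonempty subsets of $X$. For a binary relation $\succeq$ on $\mathcal{X}$, $A\succ B$ means $A\succeq B$ and not $B\succeq A$; $A\prec B$ means $B\succ A$. The axioms are: - (GF) consists of both (GF1) and (GF2). (GF1): for all $x\in X$, $A\in\mathcal{X}$, if $x\mathrel{\dot{>}}a$ for all $a\in A$, then $A\cup\{x\}\succ A$. (GF2): for all $x\in X$, $A\in\mathcal{X}$, if $x\mathrel{\dot{<}}a$ for all $a\in A$, then $A\cup\{x\}\prec A$. - (botIND) for all $A,B\in\mathcal{X}$ and all $x\in X\setminus(A\cup B)$ such that $y\mathrel{\dot{>}}x$ for all $y\in A\cup B$: $A\succ B$ implies $A\cup\{x\}\succeq B\cup\{x\}$. - (topIND) for all $A,B\in\mathcal{X}$ and all $x\in X\setminus(A\cup B)$ such that $x\mathrel{\dot{>}}y$ for all $y\in A\cup B$: $A\succ B$ implies $A\cup\{x\}\succeq B\cup\{x\}$. - (SUAv)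 for all $x,y,z\in X$: $x\mathrel{\dot{>}}y$ and $y\mathrel{\dot{>}}z$ imply $\{y\}\succ\{x,z\}$. *)

theory Defs
  imports Main
begin

text \<open>
  Both the linear order \<open>r\<close> on \<open>X\<close> and the relation \<open>R\<close> on nonempty subsets of \<open>X\<close> are read as
  ``at least as good as'': a pair \<open>(x, y)\<close> in the relation means that \<open>x\<close> weakly dominates \<open>y\<close>.
  Subsets may be infinite if \<open>X\<close> is.
\<close>

definition strict_part :: "'a rel \<Rightarrow> 'a \<Rightarrow> 'a \<Rightarrow> bool" where
  "strict_part r x y \<longleftrightarrow> (x, y) \<in> r \<and> (y, x) \<notin> r"

definition nonempty_subsets :: "'a set \<Rightarrow> 'a set set" where
  "nonempty_subsets X = Pow X - {{}}"

definition GF1 :: "'a set \<Rightarrow> 'a rel \<Rightarrow> 'a set rel \<Rightarrow> bool" where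
  "GF1 X r R \<longleftrightarrow>
    (\<forall>x\<in>X. \<forall>A\<in>nonempty_subsets X.
      (\<forall>a\<in>A. strict_part r x a) \<longrightarrow> strict_part R (A \<union> {x}) A)"

definition GF2 :: "'a set \<Rightarrow> 'a rel \<Rightarrow> 'a set rel \<Rightarrow> bool" where
  "GF2 X r R \<longleftrightarrow>
    (\<forall>x\<in>X. \<forall>A\<in>nonempty_subsets X.
      (\<forall>a\<in>A. strict_part r a x) \<longrightarrow> strict_part R A (A \<union> {x}))"

definition GF :: "'a set \<Rightarrow> 'a rel \<Rightarrow> 'a set rel \<Rightarrow> bool" where
  "GF X r R \<longleftrightarrow> GF1 X r R \<and> GF2 X r R"

definition botIND :: "'a set \<Rightarrow> 'a rel \<Rightarrow> 'a set rel \<Rightarrow> bool" where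
  "botIND X r R \<longleftrightarrow>
    (\<forall>A\<in>nonempty_subsets X. \<forall>B\<in>nonempty_subsets X. \<forall>x\<in>X - (A \<union> B).
      (\<forall>y\<in>A \<union> B. strict_part r y x) \<longrightarrow>
      strict_part R A B \<longrightarrow> (A \<union> {x}, B \<union> {x}) \<in> R)"

definition topIND :: "'a set \<Rightarrow> 'a rel \<Rightarrow> 'a set rel \<Rightarrow> bool" where
  "topIND X r R \<longleftrightarrow>
    (\<forall>A\<in>nonempty_subsets X. \<forall>B\<in>nonempty_subsets X. \<forall>x\<in>X - (A \<union> B).
      (\<forall>y\<in>A \<union> B. strict_part r x y) \<longrightarrow>
      strict_part R A B \<longrightarrow> (A \<union> {x}, B \<union> {x}) \<in> R)"

definition SUAv :: "'a set \<Rightarrow> 'a rel \<Rightarrow> 'a set rel \<Rightarrow> bool" where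
  "SUAv X r R \<longleftrightarrow>
    (\<forall>x\<in>X. \<forall>y\<in>X. \<forall>z\<in>X.
      strict_part r x y \<and> strict_part r y z \<longrightarrow> strict_part R {y} {x, z})"

end

theory Submission
  imports Defs
begin

text \<open>
  Take \<open>a < b < c < d\<close> in \<open>X\<close>. By (SUAv), \<open>{c}\<close> beats \<open>{b, d}\<close>, so (botIND) yields
  \<open>{a, c} \<succeq> {a, b, d}\<close>. The Kannai--Peleg argument, that (GF) and the independence axioms make a
  finite set as good as the set of its two extremes, gives
  \<open>{a, b, d} \<succeq> {a, d} \<succeq> {a, b, c, d}\<close> and \<open>{a, b, c} \<succeq> {a, c}\<close>. Hence
  \<open>{a, b, c} \<succeq> {a, b, c, d}\<close>, against (GF1).
\<close>

text \<open>Induction on \<open>S\<close>: a new element \<open>x\<close> is compared with the old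
  least \<open>m\<close>, and the lower of the two is least in the enlarged set.\<close>

lemma finite_has_strict_least:
  assumes "linear_order_on X r" "finite S" "S \<noteq> {}" "S \<subseteq> X"
  shows "\<exists>m\<in>S. \<forall>y\<in>S - {m}. strict_part r y m"
  using assms(2-4)
proof (induction rule: finite_ne_induct)
  case (singleton x)
  then show ?case by simp
next
  case (insert x F)
  have tot: "total_on X r" and anti: "antisym r" and tr: "trans r"
    using assms(1) by (auto simp: linear_order_on_def partial_order_on_def preorder_on_def)
  obtain m where m: "m \<in> F" "\<forall>y\<in>F - {m}. strict_part r y m"
    using insert by auto
  have "x \<noteq> m" using m insert.hyps by auto
  then consider "(x, m) \<in> r" | "(m, x) \<in> r"
    using tot m insert.prems unfolding total_on_def by blast
  then show ?case
  proof cases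
    case 1
    then have "strict_part r x m"
      using anti \<open>x \<noteq> m\<close> unfolding strict_part_def antisym_def by blast
    then show ?thesis using m by blast
  next
    case 2
    then have mx: "strict_part r m x"
      using anti \<open>x \<noteq> m\<close> unfolding strict_part_def antisym_def by blast
    have "strict_part r y x" if "y \<in> F" for y
    proof (cases "y = m")
      case False
      then have "strict_part r y m" using m that by blast
      then show ?thesis using mx tr unfolding strict_part_def by (meson transD)
    qed (use mx in simp)
    then show ?thesis by blast
  qed
qed

text \<open>The form with \<open>Suc n\<close> and \<open>n\<close> lets the lemma be iterated on
  what remains. It also makes \<open>S\<close> finite and nonempty, since infinite sets and the
  empty set have \<open>card\<close> 0.\<close>

lemma card_Suc_strict_leastE:
  assumes "linear_order_on X r" "S \<subseteq> X" "card S = Suc n"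
  obtains m where "m \<in> S" "card (S - {m}) = n" "\<forall>y\<in>S - {m}. strict_part r y m"
  using finite_has_strict_least[OF assms(1), of S] assms card.infinite[of S]
  by (metis card_Diff_singleton card.empty diff_Suc_1 nat.distinct(1))

text \<open>Least elements are peeled off one after another from a four-element subset;
  \<open>d\<close> is what is left after three rounds.\<close>

lemma four_chainE:
  assumes "linear_order_on X r" and "infinite X \<or> card X \<ge> 4"
  obtains a b c d where "{a, b, c, d} \<subseteq> X"
    "strict_part r b a" "strict_part r c a" "strict_part r d a"
    "strict_part r c b" "strict_part r d b" "strict_part r d c"
proof -
  obtain S where S: "S \<subseteq> X" "card S = Suc (Suc (Suc (Suc 0)))"
    using assms(2) infinite_arbitrarily_large[of X 4] obtain_subset_with_card_n[of 4 X]
    by (auto simp: numeral_eq_Suc)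
  obtain a where a: "a \<in> S" "card (S - {a}) = Suc (Suc (Suc 0))"
      "\<forall>y\<in>S - {a}. strict_part r y a"
    using card_Suc_strict_leastE[OF assms(1) S] .
  obtain b where b: "b \<in> S - {a}" "card (S - {a} - {b}) = Suc (Suc 0)"
      "\<forall>y\<in>S - {a} - {b}. strict_part r y b"
    using card_Suc_strict_leastE[OF assms(1) _ a(2)] S by blast
  obtain c where c: "c \<in> S - {a} - {b}" "card (S - {a} - {b} - {c}) = Suc 0"
      "\<forall>y\<in>S - {a} - {b} - {c}. strict_part r y c"
    using card_Suc_strict_leastE[OF assms(1) _ b(2)] S by blast
  obtain d where "d \<in> S - {a} - {b} - {c}"
    using c(2) by (metis card.empty ex_in_conv nat.distinct(1))
  then show ?thesis
    using that[of a b c d] a b c S(1) by blast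
qed

lemma strict_part_trans:
  assumes "trans r" "strict_part r x y" "strict_part r y z"
  shows "strict_part r x z"
  using assms unfolding strict_part_def by (meson transD)

theorem theorem5:
  fixes X :: "'a set" and r :: "'a rel"
  assumes "linear_order_on X r"
    and "infinite X \<or> card X \<ge> 4"
  shows "\<not> (\<exists>R :: 'a set rel.
    R \<subseteq> nonempty_subsets X \<times> nonempty_subsets X \<and> trans R \<and>
    GF X r R \<and> botIND X r R \<and> topIND X r R \<and> SUAv X r R)"
proof
  assume "\<exists>R :: 'a set rel.
    R \<subseteq> nonempty_subsets X \<times> nonempty_subsets X \<and> trans R \<and>
    GF X r R \<and> botIND X r R \<and> topIND X r R \<and> SUAv X r R"
  then obtain R :: "'a set rel" where tr: "trans R" and gf: "GF X r R"
    and bot: "botIND X r R" and top: "topIND X r R" and sua: "SUAv X r R"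
    by blast
  obtain a b c d where X: "{a, b, c, d} \<subseteq> X"
    and o: "strict_part r b a" "strict_part r c a" "strict_part r d a"
      "strict_part r c b" "strict_part r d b" "strict_part r d c"
    using four_chainE[OF assms] .
  \<comment> \<open>Irreflexivity turns dominance over or under \<open>A \<union> B\<close> into
    \<open>x \<notin> A \<union> B\<close>, the side condition of both independence axioms.\<close>
  have irr: "\<not> strict_part r x x" for x by (simp add: strict_part_def)
  have GF1: "strict_part R (A \<union> {x}) A"
    if "x \<in> X" "A \<subseteq> X" "A \<noteq> {}" "\<forall>y\<in>A. strict_part r x y" for x A
    using gf that unfolding GF_def GF1_def nonempty_subsets_def by blast
  have GF2: "strict_part R A (A \<union> {x})"
    if "x \<in> X" "A \<subseteq> X" "A \<noteq> {}" "\<forall>y\<in>A. strict_part r y x" for x A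
    using gf that unfolding GF_def GF2_def nonempty_subsets_def by blast
  have bot': "(A \<union> {x}, B \<union> {x}) \<in> R"
    if "strict_part R A B" "x \<in> X" "A \<subseteq> X" "A \<noteq> {}" "B \<subseteq> X" "B \<noteq> {}"
      "\<forall>y\<in>A \<union> B. strict_part r y x" for x A B
  proof -
    have "x \<notin> A \<union> B" using that(7) irr by blast
    then show ?thesis using bot that unfolding botIND_def nonempty_subsets_def by simp
  qed
  have top': "(A \<union> {x}, B \<union> {x}) \<in> R"
    if "strict_part R A B" "x \<in> X" "A \<subseteq> X" "A \<noteq> {}" "B \<subseteq> X" "B \<noteq> {}"
      "\<forall>y\<in>A \<union> B. strict_part r x y" for x A B
  proof -
    have "x \<notin> A \<union> B" using that(7) irr by blast
    then show ?thesis using top that unfolding topIND_def nonempty_subsets_def by simp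
  qed
  \<comment> \<open>The triple is \<open>d\<close>, \<open>c\<close>, \<open>b\<close>, which keeps
    \<open>a\<close> free to be added from below.\<close>
  have "strict_part R {c} {b, d}"
    using sua X o unfolding SUAv_def by (metis insert_commute insert_subset)
  from bot'[OF this, of a] have 1: "({a, c}, {a, b, d}) \<in> R"
    using X o by (simp add: insert_commute)
  \<comment> \<open>Adding \<open>d\<close> or \<open>c\<close> on top of this comparison makes
    \<open>b\<close> an inner element that does no harm.\<close>
  have ab: "strict_part R {a, b} {a}"
    using GF1[of b "{a}"] X o by (simp add: insert_commute)
  from top'[OF this, of d] have 2: "({a, b, d}, {a, d}) \<in> R"
    using X o by (simp add: insert_commute)
  from top'[OF ab, of c] have 3: "({a, b, c}, {a, c}) \<in> R"
    using X o by (simp add: insert_commute)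
  \<comment> \<open>The inner elements are added downwards from \<open>d\<close> before
    \<open>a\<close> joins, because \<open>botIND\<close> needs a strict comparison and returns only
    a weak one.\<close>
  have "strict_part R {d} {c, d}" "strict_part R {c, d} {b, c, d}"
    using GF2[of c "{d}"] GF2[of b "{c, d}"] X o by (simp_all add: insert_commute)
  then have "strict_part R {d} {b, c, d}"
    by (rule strict_part_trans[OF tr])
  from bot'[OF this, of a] have 4: "({a, d}, {a, b, c, d}) \<in> R"
    using X o by (simp add: insert_commute)
  \<comment> \<open>The links are chained in the order \<open>3\<close>, \<open>1\<close>,
    \<open>2\<close>, \<open>4\<close>.\<close>
  have "({a, b, c}, {a, b, c, d}) \<in> R"
    using 1 2 3 4 tr by (meson transD)
  moreover have "strict_part R {a, b, c, d} {a, b, c}"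
    using GF1[of d "{a, b, c}"] X o by (simp add: insert_commute)
  ultimately show False by (simp add: strict_part_def)
qed

end
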